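(* Let the Follower's market share be $S\in[0,1]$. The decentralised preemption threshold $V_P^*$ is strictly below the socially optimal deployment threshold $V_{\mathrm{social}}^*$: $$V_P^*=\frac{I}{\pi(\tau)(1-2S)}<V_{\mathrm{social}}^*=\frac{I+2(1-\pi(\tau))D}{\pi(\tau)}.$$
   Context: Two symmetric players (a Leader, who deploys first, and a Follower) race to deploy a technology (artificial general intelligence) of economic value $V$. $\tau\in(0,\infty)$ is the duration of safety research, $\lambda>0$ the safety learning rate, $\pi(\tau)=1-e^{-\lambda\tau}$ the probability of safe deployment, $I>0$ the sunk investment cost, $S\in[0,1]$ the Follower's market share (with $S\approx 0$ the expected, winner-takes-all case), and $D>0$ the cost of systemic ruin, borne by both players with probability $1-\pi(\tau)$. The payoffs are $L(V)=(1-S)\pi(\tau)V-(1-\pi(\tau))D-I$ (Leader) and $F(V)=S\pi(\tau)V-(1-\pi(\tau))D$ (Follower). The preemption threshold $V_P^*$ is the asset value solving $L(V)=F(V)$. The social planner's welfare is the joint payoff $W(V)=L(V)+F(V)=\pi(\tau)V-2(1-\pi(\tau))D-I$; the planner deploys only when $W(V)>0$, and the socially optimal threshold $V_{\mathrm{social}}^*$ is the value solving $W(V)=0$.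
   Formalization: S=1/2 is excluded for V_P* (L=F has no solution there), and the inequality V_P*<V_social*, false for some S<1/2 (π=1/2, I=D=1, S=2/5 gives 10>4), is replaced by: it holds exactly when S<(1-π)D/(I+2(1-π)D) or S>1/2. *)

theory Defs
  imports Complex_Main
begin

definition safe_prob :: "real \<Rightarrow> real \<Rightarrow> real" where
  "safe_prob lam \<tau> = 1 - exp (- lam * \<tau>)"

definition leader_payoff :: "real \<Rightarrow> real \<Rightarrow> real \<Rightarrow> real \<Rightarrow> real \<Rightarrow> real \<Rightarrow> real" where
  "leader_payoff lam \<tau> I S D V =
     (1 - S) * safe_prob lam \<tau> * V - (1 - safe_prob lam \<tau>) * D - I"

definition follower_payoff :: "real \<Rightarrow> real \<Rightarrow> real \<Rightarrow> real \<Rightarrow> real \<Rightarrow> real" where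
  "follower_payoff lam \<tau> S D V = S * safe_prob lam \<tau> * V - (1 - safe_prob lam \<tau>) * D"

definition welfare :: "real \<Rightarrow> real \<Rightarrow> real \<Rightarrow> real \<Rightarrow> real \<Rightarrow> real \<Rightarrow> real" where
  "welfare lam \<tau> I S D V = leader_payoff lam \<tau> I S D V + follower_payoff lam \<tau> S D V"

(* The defining equation has no solution for S = 1/2 and I > 0, so the definite
   description is unspecified there; for S > 1/2 its solution is negative. *)
definition preemption_threshold :: "real \<Rightarrow> real \<Rightarrow> real \<Rightarrow> real \<Rightarrow> real \<Rightarrow> real" where
  "preemption_threshold lam \<tau> I S D =
     (THE V. leader_payoff lam \<tau> I S D V = follower_payoff lam \<tau> S D V)"

definition social_threshold :: "real \<Rightarrow> real \<Rightarrow> real \<Rightarrow> real \<Rightarrow> real \<Rightarrow> real" where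
  "social_threshold lam \<tau> I S D = (THE V. welfare lam \<tau> I S D V = 0)"

end

theory Submission
  imports Defs
begin

text \<open>Write p for \<open>safe_prob lam \<tau>\<close> and K = (1 - p) D for the expected ruin
  cost of one player. Ruin cancels in L - F = p (1 - 2S) V - I but doubles in W = p V - 2K - I. Both
  are affine in V, so each threshold is a unique root once the slope is nonzero
  (\<open>social_threshold_eq\<close>, \<open>preemption_threshold_eq\<close>).
  \<open>threshold_less_iff\<close> compares the roots: the order is strict near S = 0, fails for K
  / (I + 2K) \<le> S < 1/2, and returns for S > 1/2 only because the preemption root is then
  negative. Hence an equivalence instead of an unconditional inequality.\<close>

lemma safe_prob_pos: "lam * \<tau> > 0 \<Longrightarrow> safe_prob lam \<tau> > 0"
  by (simp add: safe_prob_def)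

lemma safe_prob_less_1: "safe_prob lam \<tau> < 1"
  by (simp add: safe_prob_def)

lemma social_threshold_eq:
  assumes "safe_prob lam \<tau> \<noteq> 0"
  shows "social_threshold lam \<tau> I S D =
           (I + 2 * (1 - safe_prob lam \<tau>) * D) / safe_prob lam \<tau>"
proof -
  \<comment> \<open>The market shares S and 1 - S add up to 1, so S drops out. The equivalence
    yields existence and uniqueness together, which evaluates \<open>THE\<close>.\<close>
  have "welfare lam \<tau> I S D V = 0 \<longleftrightarrow>
          V = (I + 2 * (1 - safe_prob lam \<tau>) * D) / safe_prob lam \<tau>" for V
    using assms
    by (auto simp: welfare_def leader_payoff_def follower_payoff_def field_simps)
  then show ?thesis
    by (simp add: social_threshold_def)
qed

lemma preemption_threshold_eq:
  assumes "safe_prob lam \<tau> \<noteq> 0" and "S \<noteq> 1 / 2"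
  shows "preemption_threshold lam \<tau> I S D = I / (safe_prob lam \<tau> * (1 - 2 * S))"
proof -
  have "safe_prob lam \<tau> * (1 - 2 * S) \<noteq> 0"
    using assms by simp
  moreover have "leader_payoff lam \<tau> I S D V = follower_payoff lam \<tau> S D V \<longleftrightarrow>
          V * (safe_prob lam \<tau> * (1 - 2 * S)) = I" for V
    by (auto simp: leader_payoff_def follower_payoff_def algebra_simps)
  \<comment> \<open>Dividing an equation needs only a nonzero slope, so S > 1/2 is covered
    too.\<close>
  ultimately have "leader_payoff lam \<tau> I S D V = follower_payoff lam \<tau> S D V \<longleftrightarrow>
          V = I / (safe_prob lam \<tau> * (1 - 2 * S))" for V
    by (simp only: eq_divide_eq simp_thms if_True)
  then show ?thesis
    by (simp add: preemption_threshold_def)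
qed

text \<open>The sign of 1 - 2S decides whether clearing denominators preserves the order, hence the
  case split at 1/2.\<close>

lemma threshold_less_iff:
  fixes p I K S :: real
  assumes "p > 0" and "I > 0" and "K > 0" and "S \<noteq> 1 / 2"
  shows "I / (p * (1 - 2 * S)) < (I + 2 * K) / p \<longleftrightarrow> S < K / (I + 2 * K) \<or> S > 1 / 2"
proof (cases "S > 1 / 2")
  case True
  then have "I / (p * (1 - 2 * S)) < 0"
    using assms by (intro divide_pos_neg mult_pos_neg) auto
  also have "0 < (I + 2 * K) / p"
    using assms by simp
  finally show ?thesis
    using True by simp
next
  case False
  with assms have "1 - 2 * S > 0"
    by simp
  then have "I / (p * (1 - 2 * S)) < (I + 2 * K) / p \<longleftrightarrow> I < (I + 2 * K) * (1 - 2 * S)"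
    using assms by (simp add: divide_less_eq)
  \<comment> \<open>(I + 2K)(1 - 2S) - I = 2 (K - S (I + 2K)).\<close>
  also have "\<dots> \<longleftrightarrow> S * (I + 2 * K) < K"
    by (auto simp: algebra_simps)
  also have "\<dots> \<longleftrightarrow> S < K / (I + 2 * K)"
    using assms by (simp add: less_divide_eq)
  finally show ?thesis
    using False by simp
qed

theorem proposition5:
  fixes \<tau> lam I S D :: real
  assumes "\<tau> > 0" and "lam > 0" and "I > 0" and "D > 0"
    and "S \<in> {0..1}"
  shows "social_threshold lam \<tau> I S D =
           (I + 2 * (1 - safe_prob lam \<tau>) * D) / safe_prob lam \<tau> \<and>
         (S \<noteq> 1 / 2 \<longrightarrow>
           preemption_threshold lam \<tau> I S D = I / (safe_prob lam \<tau> * (1 - 2 * S)) \<and>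
           (preemption_threshold lam \<tau> I S D < social_threshold lam \<tau> I S D \<longleftrightarrow>
              S < (1 - safe_prob lam \<tau>) * D / (I + 2 * (1 - safe_prob lam \<tau>) * D) \<or> S > 1 / 2))"
proof -
  have p: "safe_prob lam \<tau> > 0"
    using assms by (simp add: safe_prob_pos)
  have K: "(1 - safe_prob lam \<tau>) * D > 0"
    using assms safe_prob_less_1 by simp
  have p0: "safe_prob lam \<tau> \<noteq> 0"
    using p by simp
  show ?thesis
    unfolding social_threshold_eq[OF p0]
    using preemption_threshold_eq[OF p0, of S I D] threshold_less_iff[OF p \<open>I > 0\<close> K, of S]
    \<comment> \<open>Associativity matches 2 * ((1 - p) * D), from the instance of K, with (2 * (1
      - p)) * D in the goal.\<close>
    by (metis mult.assoc)
qed

end
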